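(* Let $m,n$ be positive integers, let $\mathcal{M}=(\mathcal{M}_{kl})$ be a positive definite symmetric integral $m\times m$ matrix and let $(\lambda_0,\mu_0;\kappa_0)$ be an integral element of $H_{\mathbb{R}}^{(n,m)}$, i.e. one with $\lambda_0,\mu_0\in\mathbb{Z}^{(m,n)}$ and $\kappa_0\in\mathbb{Z}^{(m,m)}$. Then for every Schwartz function $f\in\mathscr{S}(\mathbb{R}^{(m,n)})$ we have $$\Theta_f^{[\mathcal{M}]}(\tau,\phi\,;\,\lambda+\lambda_0,\ \mu+\mu_0,\ \kappa+\kappa_0+\lambda_0\,{}^t\mu-\mu_0\,{}^t\lambda)=e^{\pi i\,\sigma(\mathcal{M}(\kappa_0+\mu_0\,{}^t\lambda_0))}\;\Theta_f^{[\mathcal{M}]}(\tau,\phi\,;\lambda,\mu,\kappa)$$ for all $(\tau,\phi)\in SL(2,\mathbb{R})$ (with $\tau\in\mathbb{H}_1$, $\phi\in[0,2\pi)$) and all $(\lambda,\mu;\kappa)\in H_{\mathbb{R}}^{(n,m)}$.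
   Context: Notation: $F^{(k,l)}$ is the set of $k\times l$ matrices over $F$; ${}^tA$ is the transpose; $\sigma(A)$ is the trace of a square matrix $A$; $i=\sqrt{-1}$; $\mathbb{H}_1=\{\tau=u+iv\in\mathbb{C}: v>0\}$. Heisenberg group: $H_{\mathbb{R}}^{(n,m)}=\{(\lambda,\mu;\kappa): \lambda,\mu\in\mathbb{R}^{(m,n)},\ \kappa\in\mathbb{R}^{(m,m)},\ \kappa+\mu\,{}^t\lambda \text{ symmetric}\}$, with multiplication $(\lambda,\mu;\kappa)\circ(\lambda',\mu';\kappa')=(\lambda+\lambda',\mu+\mu';\kappa+\kappa'+\lambda\,{}^t\mu'-\mu\,{}^t\lambda')$. For $x,y\in\mathbb{R}^{(m,n)}$ put $(x,y)_{\mathcal{M}}=\sigma({}^tx\mathcal{M}y)$ and $\|x\|_{\mathcal{M}}=\sqrt{(x,x)_{\mathcal{M}}}$. Schrödinger representation: for $(\lambda,\mu;\kappa)\in H_{\mathbb{R}}^{(n,m)}$ and $f\in L^2(\mathbb{R}^{(m,n)})$, $$[\mathscr{W}_{\mathcal{M}}(\lambda,\mu;\kappa)f](x)=e^{\pi i\,\sigma\{\mathcal{M}(\kappa+\mu\,{}^t\lambda+2x\,{}^t\mu)\}}f(x+\lambda).$$ Coordinates on $SL(2,\mathbb{R})$: by the Iwasawa decomposition each element is uniquely $$(\tau,\phi):=\begin{pmatrix}1&u\\0&1\end{pmatrix}\begin{pmatrix}v^{1/2}&0\\0&v^{-1/2}\end{pmatrix}\begin{pmatrix}\cos\phi&-\sin\phi\\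 \sin\phi&\cos\phi\end{pmatrix},\quad \tau=u+iv\in\mathbb{H}_1,\ \phi\in[0,2\pi).$$ Operators $R_{\mathcal{M}}(\tau,\phi)$: $[R_{\mathcal{M}}(\tau,\phi)f](x)=v^{mn/4}e^{\pi i u\|x\|_{\mathcal{M}}^2}[R_{\mathcal{M}}(i,\phi)f](v^{1/2}x)$, where $[R_{\mathcal{M}}(i,\phi)f](x)$ equals $f(x)$ if $\phi\equiv0 \bmod 2\pi$, equals $f(-x)$ if $\phi\equiv\pi\bmod 2\pi$, and otherwise equals $$(\det\mathcal{M})^{\frac n2}|\sin\phi|^{-\frac{mn}2}\int_{\mathbb{R}^{(m,n)}}\exp\left(\pi i\,\frac{(\|x\|_{\mathcal{M}}^2+\|y\|_{\mathcal{M}}^2)\cos\phi-2(x,y)_{\mathcal{M}}}{\sin\phi}\right)f(y)\,dy.$$ Theta sum of index $\mathcal{M}$: for $f\in\mathscr{S}(\mathbb{R}^{(m,n)})$, $$\Theta_f^{[\mathcal{M}]}(\tau,\phi;\lambda,\mu,\kappa):=\sum_{\omega\in\mathbb{Z}^{(m,n)}}\left[\mathscr{W}_{\mathcal{M}}(\lambda,\mu;\kappa)R_{\mathcal{M}}(\tau,\phi)f\right](\omega).$$ *)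

theory Defs
  imports "HOL-Analysis.Analysis" "HOL-Library.Real_Mod"
begin

text \<open>
  A real \<open>m \<times> n\<close> matrix is an element of \<^typ>\<open>real ^ 'n ^ 'm\<close> (\<open>'m\<close> indexes the rows), so
  \<open>m = CARD('m)\<close> and \<open>n = CARD('n)\<close>, both automatically positive. Lebesgue measure on
  matrices is \<^const>\<open>lborel\<close> of the Euclidean space \<^typ>\<open>real ^ 'n ^ 'm\<close>.
\<close>

definition integral_matrices :: "(real ^ 'n ^ 'm) set" where
  "integral_matrices = {A. \<forall>i j. A $ i $ j \<in> \<int>}"

definition symmetric_matrix :: "real ^ 'm ^ 'm \<Rightarrow> bool" where
  "symmetric_matrix A \<longleftrightarrow> transpose A = A"

definition positive_definite :: "real ^ 'm ^ 'm \<Rightarrow> bool" where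
  "positive_definite A \<longleftrightarrow> (\<forall>x. x \<noteq> 0 \<longrightarrow> x \<bullet> (A *v x) > 0)"

definition heisenberg :: "((real ^ 'n ^ 'm) \<times> (real ^ 'n ^ 'm) \<times> (real ^ 'm ^ 'm)) set" where
  "heisenberg = {(l, \<mu>, \<kappa>). symmetric_matrix (\<kappa> + \<mu> ** transpose l)}"

text \<open>
  \<open>iter_partial [b\<^sub>1, \<dots>, b\<^sub>k] f\<close> is \<open>\<partial>\<^sub>b\<^sub>1 (\<dots> (\<partial>\<^sub>b\<^sub>k f))\<close>. It is the genuine iterated derivative
  only where the inner functions are differentiable, which the definition of Schwartz
  functions below demands at every stage and every point (so such functions are smooth).
\<close>

fun iter_partial ::
    "'a list \<Rightarrow> ('a::euclidean_space \<Rightarrow> complex) \<Rightarrow> 'a \<Rightarrow> complex" where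
  "iter_partial [] f = f"
| "iter_partial (b # bs) f = (\<lambda>x. frechet_derivative (iter_partial bs f) (at x) b)"

definition schwartz :: "('a::euclidean_space \<Rightarrow> complex) set" where
  "schwartz = {f. \<forall>bs. set bs \<subseteq> Basis \<longrightarrow>
      (\<forall>x. iter_partial bs f differentiable (at x)) \<and>
      (\<forall>k::nat. bounded (range (\<lambda>x. norm x ^ k * norm (iter_partial bs f x))))}"

definition inner_M :: "real ^ 'm ^ 'm \<Rightarrow> real ^ 'n ^ 'm \<Rightarrow> real ^ 'n ^ 'm \<Rightarrow> real" where
  "inner_M M x y = trace (transpose x ** M ** y)"

definition norm_M :: "real ^ 'm ^ 'm \<Rightarrow> real ^ 'n ^ 'm \<Rightarrow> real" where
  "norm_M M x = sqrt (inner_M M x x)"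

text \<open>
  The operators act on functions rather than on almost-everywhere classes, since the
  theta sum evaluates their results at lattice points.
\<close>

definition schroedinger ::
    "real ^ 'm ^ 'm \<Rightarrow> real ^ 'n ^ 'm \<Rightarrow> real ^ 'n ^ 'm \<Rightarrow> real ^ 'm ^ 'm \<Rightarrow>
     (real ^ 'n ^ 'm \<Rightarrow> complex) \<Rightarrow> real ^ 'n ^ 'm \<Rightarrow> complex" where
  "schroedinger M l \<mu> \<kappa> f x =
     exp (of_real pi * \<i> *
       of_real (trace (M ** (\<kappa> + \<mu> ** transpose l + 2 *\<^sub>R (x ** transpose \<mu>))))) * f (x + l)"

definition R_rot ::
    "real ^ 'm ^ 'm \<Rightarrow> real \<Rightarrow>
     (real ^ 'n ^ 'm \<Rightarrow> complex) \<Rightarrow> real ^ 'n ^ 'm \<Rightarrow> complex" where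
  "R_rot M \<phi> f x =
     (if [\<phi> = 0] (rmod (2 * pi)) then f x
      else if [\<phi> = pi] (rmod (2 * pi)) then f (- x)
      else of_real (det M powr (real CARD('n) / 2)
             * \<bar>sin \<phi>\<bar> powr (- (real CARD('m) * real CARD('n) / 2))) *
           (\<integral>y. exp (of_real pi * \<i> *
                of_real ((((norm_M M x)\<^sup>2 + (norm_M M y)\<^sup>2) * cos \<phi> - 2 * inner_M M x y) / sin \<phi>))
              * f y \<partial>lborel))"

text \<open>
  The pair \<open>(\<tau>, \<phi>)\<close>, with \<open>Im \<tau> > 0\<close> and \<open>0 \<le> \<phi> < 2\<pi>\<close>, stands for the element of \<open>SL(2, \<real>)\<close>
  having these Iwasawa coordinates; \<open>R_rot\<close> is the case \<open>\<tau> = \<i>\<close>.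
\<close>

definition R_op ::
    "real ^ 'm ^ 'm \<Rightarrow> complex \<Rightarrow> real \<Rightarrow>
     (real ^ 'n ^ 'm \<Rightarrow> complex) \<Rightarrow> real ^ 'n ^ 'm \<Rightarrow> complex" where
  "R_op M \<tau> \<phi> f x =
     of_real (Im \<tau> powr (real CARD('m) * real CARD('n) / 4)) *
     exp (of_real pi * \<i> * of_real (Re \<tau> * (norm_M M x)\<^sup>2)) *
     R_rot M \<phi> f (sqrt (Im \<tau>) *\<^sub>R x)"

definition theta_sum ::
    "real ^ 'm ^ 'm \<Rightarrow> (real ^ 'n ^ 'm \<Rightarrow> complex) \<Rightarrow> complex \<Rightarrow> real \<Rightarrow>
     real ^ 'n ^ 'm \<Rightarrow> real ^ 'n ^ 'm \<Rightarrow> real ^ 'm ^ 'm \<Rightarrow> complex" where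
  "theta_sum M f \<tau> \<phi> l \<mu> \<kappa> =
     (\<Sum>\<^sub>\<infinity>\<omega>\<in>integral_matrices. schroedinger M l \<mu> \<kappa> (R_op M \<tau> \<phi> f) \<omega>)"

end

theory Submission
  imports Defs
begin

text \<open>
  The sum over the lattice of integral matrices does not change when the summation variable
  is translated by the integral matrix \<open>l0\<close>. After this translation both sides of the
  identity evaluate \<open>R_op M \<tau> \<phi> f\<close> at the same points, so only the Schroedinger phases have to
  be compared, term by term. Writing the exponents as \<open>\<pi> \<i>\<close> times a trace, they differ by the
  constant \<open>trace (M (\<kappa>0 + \<mu>0 l0\<^sup>T))\<close> of the automorphy factor and by two further terms: the
  trace of \<open>M (\<mu> l0\<^sup>T - l0 \<mu>\<^sup>T)\<close>, which vanishes because \<open>M\<close> is symmetric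
  (\<open>trace_symmetric_mult_transpose_commute\<close>), and \<open>2 trace (M \<omega> \<mu>0\<^sup>T)\<close>, which is an even
  integer because all matrices in it are integral. Neither is seen by the exponential.

  In other words, the functional \<open>F \<mapsto> \<Sum>\<omega>. F \<omega>\<close> is an eigenvector for the integral elements of
  the Heisenberg group, whatever \<open>F\<close> is (\<open>infsum_schroedinger_integral_shift\<close>): translation and
  multiplication by a number of modulus one preserve summability, so the two sums either
  converge together or both have the default value \<open>0\<close>.
\<close>

lemma integral_matrices_add:
  "A \<in> integral_matrices \<Longrightarrow> B \<in> integral_matrices \<Longrightarrow> A + B \<in> integral_matrices"
  by (auto simp: integral_matrices_def)

lemma integral_matrices_diff:
  "A \<in> integral_matrices \<Longrightarrow> B \<in> integral_matrices \<Longrightarrow> A - B \<in> integral_matrices"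
  by (auto simp: integral_matrices_def)

lemma integral_matrices_transpose:
  "A \<in> integral_matrices \<Longrightarrow> transpose A \<in> integral_matrices"
  by (auto simp: integral_matrices_def transpose_def)

lemma integral_matrices_mult:
  "A \<in> integral_matrices \<Longrightarrow> B \<in> integral_matrices \<Longrightarrow> A ** B \<in> integral_matrices"
  by (auto simp: integral_matrices_def matrix_matrix_mult_def)

lemma trace_integral_matrix: "A \<in> integral_matrices \<Longrightarrow> trace A \<in> \<int>"
  by (auto simp: integral_matrices_def trace_def)

text \<open>
  Transposing a matrix keeps its trace, and the transpose of \<open>M A B\<^sup>T\<close> is a cyclic permutation
  of \<open>M B A\<^sup>T\<close>.
\<close>

lemma trace_symmetric_mult_transpose_commute:
  fixes M :: "real ^ 'm ^ 'm" and A B :: "real ^ 'n ^ 'm"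
  assumes "symmetric_matrix M"
  shows "trace (M ** (A ** transpose B)) = trace (M ** (B ** transpose A))"
proof -
  have "trace (M ** (A ** transpose B)) = trace (transpose (M ** (A ** transpose B)))"
    by (simp add: trace_def transpose_def)
  also have "\<dots> = trace ((B ** transpose A) ** M)"
    using assms by (simp add: matrix_transpose_mul symmetric_matrix_def)
  also have "\<dots> = trace (M ** (B ** transpose A))"
    by (rule trace_mul_sym)
  finally show ?thesis .
qed

lemma bij_betw_add_integral_matrix:
  assumes "A \<in> integral_matrices"
  shows "bij_betw (\<lambda>\<omega>. \<omega> + A) integral_matrices integral_matrices"
  by (rule bij_betw_byWitness[where f' = "\<lambda>\<omega>. \<omega> - A"])
     (use assms in \<open>auto intro: integral_matrices_add integral_matrices_diff\<close>)

lemma exp_pi_even_shift: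
  assumes "k \<in> \<int>"
  shows "exp (of_real pi * \<i> * of_real (a + 2 * k)) = exp (of_real pi * \<i> * of_real a)"
proof -
  have "exp (of_real pi * \<i> * of_real (a + 2 * k)) =
        exp (of_real pi * \<i> * of_real a) * exp (of_real (2 * k * pi) * \<i>)"
    by (simp add: exp_add[symmetric] algebra_simps)
  moreover have "exp (of_real (2 * k * pi) * \<i>) = 1"
    using exp_integer_2pi[of "of_real k"] assms by simp
  ultimately show ?thesis by simp
qed

text \<open>
  The three summands are the phase of the untranslated operator at \<open>\<omega> + l0\<close>, the automorphy
  factor, and a term that is an even integer for integral \<open>M\<close>, \<open>\<omega>\<close> and \<open>\<mu>0\<close>.
\<close>

lemma trace_schroedinger_phase:
  fixes M \<kappa> \<kappa>0 :: "real ^ 'm ^ 'm" and l l0 \<mu> \<mu>0 \<omega> :: "real ^ 'n ^ 'm"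
  assumes "symmetric_matrix M"
  shows "trace (M ** ((\<kappa> + \<kappa>0 + l0 ** transpose \<mu> - \<mu>0 ** transpose l)
            + (\<mu> + \<mu>0) ** transpose (l + l0) + 2 *\<^sub>R (\<omega> ** transpose (\<mu> + \<mu>0))))
       = trace (M ** (\<kappa> + \<mu> ** transpose l + 2 *\<^sub>R ((\<omega> + l0) ** transpose \<mu>)))
         + trace (M ** (\<kappa>0 + \<mu>0 ** transpose l0))
         + 2 * trace (M ** (\<omega> ** transpose \<mu>0))"
proof -
  have transpose_add: "transpose (A + B) = transpose A + transpose B"
    for A B :: "real ^ 'n ^ 'm"
    by (simp add: transpose_def vec_eq_iff)
  have add_mult: "(A + B) ** C = A ** C + B ** C"
    for A B :: "real ^ 'n ^ 'm" and C :: "real ^ 'm ^ 'n"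
    by (simp add: matrix_matrix_mult_def vec_eq_iff sum.distrib distrib_right)
  have trace_scale: "trace (M ** (2 *\<^sub>R A)) = 2 * trace (M ** A)" for A :: "real ^ 'm ^ 'm"
    by (simp add: trace_def matrix_matrix_mult_def sum_distrib_left mult.left_commute)
  have trace_mult_add: "trace (M ** (A + B)) = trace (M ** A) + trace (M ** B)"
    for A B :: "real ^ 'm ^ 'm"
    by (simp add: matrix_add_ldistrib trace_add)
  have trace_mult_diff: "trace (M ** (A - B)) = trace (M ** A) - trace (M ** B)"
    for A B :: "real ^ 'm ^ 'm"
    using trace_mult_add[of "A - B" B] by simp
  show ?thesis
    using trace_symmetric_mult_transpose_commute[OF assms, of \<mu> l0]
    by (simp add: transpose_add add_mult matrix_add_ldistrib[of _ "transpose _"]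
          trace_mult_add trace_mult_diff trace_scale)
qed

lemma schroedinger_integral_shift:
  fixes M \<kappa> \<kappa>0 :: "real ^ 'm ^ 'm" and l l0 \<mu> \<mu>0 \<omega> :: "real ^ 'n ^ 'm"
  assumes "symmetric_matrix M" "M \<in> integral_matrices"
    and "\<mu>0 \<in> integral_matrices" "\<omega> \<in> integral_matrices"
  shows "schroedinger M (l + l0) (\<mu> + \<mu>0)
           (\<kappa> + \<kappa>0 + l0 ** transpose \<mu> - \<mu>0 ** transpose l) F \<omega>
         = exp (of_real pi * \<i> * of_real (trace (M ** (\<kappa>0 + \<mu>0 ** transpose l0))))
           * schroedinger M l \<mu> \<kappa> F (\<omega> + l0)"
proof -
  let ?a = "trace (M ** (\<kappa> + \<mu> ** transpose l + 2 *\<^sub>R ((\<omega> + l0) ** transpose \<mu>)))"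
  let ?b = "trace (M ** (\<kappa>0 + \<mu>0 ** transpose l0))"
  have "trace (M ** (\<omega> ** transpose \<mu>0)) \<in> \<int>"
    using assms
    by (intro trace_integral_matrix integral_matrices_mult integral_matrices_transpose)
  then have "schroedinger M (l + l0) (\<mu> + \<mu>0)
               (\<kappa> + \<kappa>0 + l0 ** transpose \<mu> - \<mu>0 ** transpose l) F \<omega>
             = exp (of_real pi * \<i> * of_real (?a + ?b)) * F (\<omega> + (l + l0))"
    unfolding schroedinger_def trace_schroedinger_phase[OF assms(1)]
    by (simp only: exp_pi_even_shift)
  also have "exp (of_real pi * \<i> * of_real (?a + ?b)) =
             exp (of_real pi * \<i> * of_real ?b) * exp (of_real pi * \<i> * of_real ?a)"
    by (simp only: of_real_add distrib_left exp_add mult.commute)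
  finally show ?thesis
    by (simp add: schroedinger_def ac_simps)
qed

lemma infsum_schroedinger_integral_shift:
  fixes M \<kappa> \<kappa>0 :: "real ^ 'm ^ 'm" and l l0 \<mu> \<mu>0 :: "real ^ 'n ^ 'm"
  assumes "symmetric_matrix M" "M \<in> integral_matrices"
    and "l0 \<in> integral_matrices" "\<mu>0 \<in> integral_matrices"
  shows "(\<Sum>\<^sub>\<infinity>\<omega>\<in>integral_matrices. schroedinger M (l + l0) (\<mu> + \<mu>0)
           (\<kappa> + \<kappa>0 + l0 ** transpose \<mu> - \<mu>0 ** transpose l) F \<omega>)
         = exp (of_real pi * \<i> * of_real (trace (M ** (\<kappa>0 + \<mu>0 ** transpose l0))))
           * (\<Sum>\<^sub>\<infinity>\<omega>\<in>integral_matrices. schroedinger M l \<mu> \<kappa> F \<omega>)"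
  (is "?lhs = ?c * _")
proof -
  have "?lhs = (\<Sum>\<^sub>\<infinity>\<omega>\<in>integral_matrices. ?c * schroedinger M l \<mu> \<kappa> F (\<omega> + l0))"
    by (rule infsum_cong) (rule schroedinger_integral_shift[OF assms(1,2,4)])
  also have "\<dots> = ?c * (\<Sum>\<^sub>\<infinity>\<omega>\<in>integral_matrices. schroedinger M l \<mu> \<kappa> F (\<omega> + l0))"
    by (rule infsum_cmult_right')
  also have "(\<Sum>\<^sub>\<infinity>\<omega>\<in>integral_matrices. schroedinger M l \<mu> \<kappa> F (\<omega> + l0))
             = (\<Sum>\<^sub>\<infinity>\<omega>\<in>integral_matrices. schroedinger M l \<mu> \<kappa> F \<omega>)"
    by (rule infsum_reindex_bij_betw[OF bij_betw_add_integral_matrix[OF assms(3)]])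
  finally show ?thesis .
qed

theorem theorem3p3:
  fixes M :: "real ^ 'm ^ 'm"
    and l0 \<mu>0 l \<mu> :: "real ^ 'n ^ 'm"
    and \<kappa>0 \<kappa> :: "real ^ 'm ^ 'm"
    and f :: "real ^ 'n ^ 'm \<Rightarrow> complex"
    and \<tau> :: complex and \<phi> :: real
  assumes "positive_definite M" and "symmetric_matrix M" and "M \<in> integral_matrices"
    and "(l0, \<mu>0, \<kappa>0) \<in> heisenberg"
    and "l0 \<in> integral_matrices" and "\<mu>0 \<in> integral_matrices" and "\<kappa>0 \<in> integral_matrices"
    and "f \<in> schwartz"
    and "Im \<tau> > 0" and "\<phi> \<in> {0..<2 * pi}"
    and "(l, \<mu>, \<kappa>) \<in> heisenberg"
  shows "theta_sum M f \<tau> \<phi> (l + l0) (\<mu> + \<mu>0)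
           (\<kappa> + \<kappa>0 + l0 ** transpose \<mu> - \<mu>0 ** transpose l)
         = exp (of_real pi * \<i> * of_real (trace (M ** (\<kappa>0 + \<mu>0 ** transpose l0))))
           * theta_sum M f \<tau> \<phi> l \<mu> \<kappa>"
  unfolding theta_sum_def
  using assms(2,3,5,6) by (rule infsum_schroedinger_integral_shift)

end
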